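(* Let $T>0$, let $\{X_t\}_{t\in[0,T]}$ be a Responsive Fractional Brownian Motion whose response function $H:[0,T]\times\mathbb{R}\to(0,1)$ is Lipschitz-Hölder with $h_{\min}\le H(t,x)\le h_{\max}$ for all $(t,x)$, where $0<h_{\min}\le h_{\max}<1$, and let $\rho(t,s;X)$, $0\le s<t\le T$, be its attention weights. Put $$A_1=A_2=A_3=A_4=\frac{\sqrt{h_{\min}}\,(h_{\min}+1/2)}{\sqrt{h_{\max}}},\qquad B_1=B_2=B_3=B_4=\frac{\sqrt{h_{\max}}\,(h_{\max}+1/2)}{\sqrt{h_{\min}}},$$ $$A_5=\frac{\sqrt{h_{\min}}\,(h_{\min}+1/2)}{2\sqrt{h_{\max}}},\qquad B_5=\frac{2\sqrt{h_{\max}}\,(h_{\max}+1/2)}{\sqrt{h_{\min}}}.$$ Then, for $\mathbb{P}$-almost every sample path, the following bounds hold. Case I: $t\le1$. (a) If $t-s<1$: $\ A_1(t-s)^{h_{\max}-1/2}\le\rho(t,s;X)\le B_1(t-s)^{h_{\min}-h_{\max}-1}$. (b) If $t-s=1$ (so $t=1$, $s=0$): $\ A_2\le\rho(1,0;X)\le B_2$. Case II: $t>1$. (a) If $t-s<1$: $\ A_3\,\dfrac{(t-s)^{h_{\max}-1/2}}{t^{h_{\max}+1/2}}\le\rho(t,s;X)\le B_3\,(t-s)^{-1}$. (b) If $t-s>1$: $\ A_4\,\dfrac{(t-s)^{h_{\min}-1/2}}{t^{h_{\max}+1/2}}\le\rho(t,s;X)\le B_4\,(t-s)^{h_{\max}-h_{\min}-1}$.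 (c) If $t-s=1$: $\ A_5\,\dfrac1{t^{h_{\max}+1/2}}\le\rho(t,t-1;X)\le B_5\,\dfrac1{t^{h_{\min}+1/2}}$.
   Context: Lipschitz-Hölder response function: $H:[0,T]\times\mathbb{R}\to(0,1)$ such that there are constants $L_H>0$, $C_H>0$, $\gamma\in(0,1]$, $0<h_{\min}\le h_{\max}<1$ with, for all $t,s\in[0,T]$, $x,y\in\mathbb{R}$: (i) $|H(t,x)-H(t,y)|\le L_H|x-y|$; (ii) $|H(t,x)-H(s,x)|\le C_H|t-s|^\gamma$; (iii) $h_{\min}\le H(t,x)\le h_{\max}$. Responsive Fractional Brownian Motion (RfBm): on a filtered probability space $(\Omega,\mathcal{F},(\mathcal{F}_t)_{t\in[0,T]},\mathbb{P})$ satisfying the usual conditions with a standard $(\mathcal{F}_t)$-Brownian motion $B$, an $(\mathcal{F}_t)$-adapted process $\{X_t\}_{t\in[0,T]}$ with almost surely continuous paths such that for each $t\in[0,T]$ the Itô integral $\int_0^tK(t,s;X_s)\,dB(s)$ is well-defined and $X_t=\int_0^tK(t,s;X_s)\,dB(s)$ $\mathbb{P}$-almost surely, where $$K(t,s;X_s)=\sqrt{2H(s,X_s)}\,(t-s)^{H(s,X_s)-1/2},\qquad0\le s<t.$$ Attention weights: for $\mathbb{P}$-almost every sample path, for $t\in(0,T]$ and $0\le s<t$, $$\rho(t,s;X):=\frac{K(t,s;X_s)}{\int_0^tK(t,u;X_u)\,du}.$$ *)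

theory Defs
  imports "HOL-Probability.Probability"
begin

section \<open>Filtered probability spaces and Brownian motion on \<open>[0,T]\<close>\<close>

text \<open>
  The time set is \<open>[0,T]\<close>; the values of the filtration and of the processes at other real
  indices are irrelevant. (The library locale \<^locale>\<open>filtration\<close> uses a whole type as time set.)
  Only the sigma-algebra of \<open>F t\<close> matters, not the measure it carries.
\<close>

locale usual_filtered_prob_space = prob_space M + complete_measure M
  for M :: "'a measure" +
  fixes T :: real and F :: "real \<Rightarrow> 'a measure"
  assumes subalgebra_F: "\<And>t. t \<in> {0..T} \<Longrightarrow> subalgebra M (F t)"
    and F_mono: "\<And>s t. 0 \<le> s \<Longrightarrow> s \<le> t \<Longrightarrow> t \<le> T \<Longrightarrow> sets (F s) \<subseteq> sets (F t)"
    and null_sets_F0: "null_sets M \<subseteq> sets (F 0)"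
    and F_right_continuous: "\<And>t. t \<in> {0..<T} \<Longrightarrow> sets (F t) = (\<Inter>u\<in>{t<..T}. sets (F u))"

locale standard_brownian_motion = usual_filtered_prob_space M T F
  for M :: "'a measure" and T :: real and F :: "real \<Rightarrow> 'a measure" +
  fixes B :: "real \<Rightarrow> 'a \<Rightarrow> real"
  assumes B_adapted: "\<And>t. t \<in> {0..T} \<Longrightarrow> B t \<in> borel_measurable (F t)"
    and B_0: "AE \<omega> in M. B 0 \<omega> = 0"
    and B_increment: "\<And>s t. 0 \<le> s \<Longrightarrow> s < t \<Longrightarrow> t \<le> T \<Longrightarrow>
      distributed M lborel (\<lambda>\<omega>. B t \<omega> - B s \<omega>) (normal_density 0 (sqrt (t - s)))"
    and B_indep: "\<And>s t. 0 \<le> s \<Longrightarrow> s < t \<Longrightarrow> t \<le> T \<Longrightarrow>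
      indep_set (sets (F s))
        (sets (vimage_algebra (space M) (\<lambda>\<omega>. B t \<omega> - B s \<omega>) borel))"
    and B_continuous: "AE \<omega> in M. continuous_on {0..T} (\<lambda>t. B t \<omega>)"

section \<open>The Ito integral\<close>

text \<open>
  A simple integrand on \<open>[0,t]\<close> is given by a partition \<open>0 = \<tau> 0 \<le> \<dots> \<le> \<tau> n = t\<close> and bounded
  coefficients \<open>\<xi> i\<close> measurable with respect to \<open>F (\<tau> i)\<close>.
\<close>

definition simple_integrand ::
  "'a measure \<Rightarrow> (real \<Rightarrow> 'a measure) \<Rightarrow> real \<Rightarrow> nat \<Rightarrow> (nat \<Rightarrow> real) \<Rightarrow> (nat \<Rightarrow> 'a \<Rightarrow> real) \<Rightarrow> bool"
where
  "simple_integrand M F t n \<tau> \<xi> \<longleftrightarrow>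
     \<tau> 0 = 0 \<and> \<tau> n = t \<and> (\<forall>i<n. \<tau> i \<le> \<tau> (Suc i)) \<and>
     (\<forall>i<n. \<xi> i \<in> borel_measurable (F (\<tau> i)) \<and> bounded (\<xi> i ` space M))"

definition simple_process ::
  "nat \<Rightarrow> (nat \<Rightarrow> real) \<Rightarrow> (nat \<Rightarrow> 'a \<Rightarrow> real) \<Rightarrow> real \<Rightarrow> 'a \<Rightarrow> real"
where
  "simple_process n \<tau> \<xi> s \<omega> = (\<Sum>i<n. \<xi> i \<omega> * indicator {\<tau> i<..\<tau> (Suc i)} s)"

definition simple_ito_integral ::
  "(real \<Rightarrow> 'a \<Rightarrow> real) \<Rightarrow> nat \<Rightarrow> (nat \<Rightarrow> real) \<Rightarrow> (nat \<Rightarrow> 'a \<Rightarrow> real) \<Rightarrow> 'a \<Rightarrow> real"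
where
  "simple_ito_integral B n \<tau> \<xi> \<omega> = (\<Sum>i<n. \<xi> i \<omega> * (B (\<tau> (Suc i)) \<omega> - B (\<tau> i) \<omega>))"

definition progressively_measurable ::
  "(real \<Rightarrow> 'a measure) \<Rightarrow> real \<Rightarrow> (real \<Rightarrow> 'a \<Rightarrow> real) \<Rightarrow> bool"
where
  "progressively_measurable F t \<psi> \<longleftrightarrow>
     (\<forall>u\<in>{0..<t}. (\<lambda>(s, \<omega>). \<psi> s \<omega>) \<in> borel_measurable (restrict_space borel {0..u} \<Otimes>\<^sub>M F u))"

text \<open>
  Square-integrable integrands on \<open>[0,t)\<close>. Processes are considered up to indistinguishability:
  an adapted process whose paths are continuous only almost surely need not be jointly
  measurable itself, but it is indistinguishable from a progressively measurable one.
  The endpoint \<open>t\<close> is left out because it is Lebesgue-null and the kernel below is singular there.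
\<close>

definition ito_integrable ::
  "'a measure \<Rightarrow> (real \<Rightarrow> 'a measure) \<Rightarrow> real \<Rightarrow> (real \<Rightarrow> 'a \<Rightarrow> real) \<Rightarrow> bool"
where
  "ito_integrable M F t \<phi> \<longleftrightarrow>
     (\<exists>\<psi>. progressively_measurable F t \<psi> \<and> (AE \<omega> in M. \<forall>s\<in>{0..<t}. \<phi> s \<omega> = \<psi> s \<omega>)) \<and>
     (\<integral>\<^sup>+\<omega>. (\<integral>\<^sup>+s\<in>{0..<t}. ennreal ((\<phi> s \<omega>)\<^sup>2) \<partial>lborel) \<partial>M) < \<infinity>"

text \<open>
  \<open>has_ito_integral M F B t \<phi> I\<close>: the integral of \<open>\<phi>\<close> over \<open>[0,t]\<close> against \<open>B\<close> is well-defined and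
  equals \<open>I\<close> almost surely. As usual, \<open>I\<close> is the mean-square limit of the integrals of simple
  integrands that approximate \<open>\<phi>\<close> in \<open>L\<^sup>2([0,t] \<times> \<Omega>)\<close>; it is unique up to null sets by the Ito
  isometry.
\<close>

definition has_ito_integral ::
  "'a measure \<Rightarrow> (real \<Rightarrow> 'a measure) \<Rightarrow> (real \<Rightarrow> 'a \<Rightarrow> real) \<Rightarrow> real \<Rightarrow>
   (real \<Rightarrow> 'a \<Rightarrow> real) \<Rightarrow> ('a \<Rightarrow> real) \<Rightarrow> bool"
where
  "has_ito_integral M F B t \<phi> I \<longleftrightarrow>
     ito_integrable M F t \<phi> \<and> I \<in> borel_measurable M \<and>
     (\<exists>n \<tau> \<xi>. (\<forall>k. simple_integrand M F t (n k) (\<tau> k) (\<xi> k)) \<and>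
        (\<lambda>k. \<integral>\<^sup>+\<omega>. (\<integral>\<^sup>+s\<in>{0..<t}.
            ennreal ((simple_process (n k) (\<tau> k) (\<xi> k) s \<omega> - \<phi> s \<omega>)\<^sup>2) \<partial>lborel) \<partial>M)
          \<longlonglongrightarrow> 0 \<and>
        (\<lambda>k. \<integral>\<^sup>+\<omega>. ennreal ((simple_ito_integral B (n k) (\<tau> k) (\<xi> k) \<omega> - I \<omega>)\<^sup>2) \<partial>M)
          \<longlonglongrightarrow> 0)"

section \<open>Responsive fractional Brownian motion\<close>

definition lipschitz_hoelder_response ::
  "real \<Rightarrow> real \<Rightarrow> real \<Rightarrow> (real \<Rightarrow> real \<Rightarrow> real) \<Rightarrow> bool"
where
  "lipschitz_hoelder_response T h_min h_max H \<longleftrightarrow>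
     0 < h_min \<and> h_min \<le> h_max \<and> h_max < 1 \<and>
     (\<forall>t\<in>{0..T}. \<forall>x. h_min \<le> H t x \<and> H t x \<le> h_max) \<and>
     (\<exists>L>0. \<forall>t\<in>{0..T}. \<forall>x y. \<bar>H t x - H t y\<bar> \<le> L * \<bar>x - y\<bar>) \<and>
     (\<exists>C>0. \<exists>\<gamma>. 0 < \<gamma> \<and> \<gamma> \<le> 1 \<and>
        (\<forall>t\<in>{0..T}. \<forall>s\<in>{0..T}. \<forall>x. \<bar>H t x - H s x\<bar> \<le> C * \<bar>t - s\<bar> powr \<gamma>))"

text \<open>The kernel \<open>K(t,s;x)\<close>; it is meant for \<open>0 \<le> s < t\<close> only.\<close>

definition rfbm_kernel :: "(real \<Rightarrow> real \<Rightarrow> real) \<Rightarrow> real \<Rightarrow> real \<Rightarrow> real \<Rightarrow> real"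
where
  "rfbm_kernel H t s x = sqrt (2 * H s x) * (t - s) powr (H s x - 1 / 2)"

locale responsive_fbm = standard_brownian_motion M T F B
  for M :: "'a measure" and T :: real and F :: "real \<Rightarrow> 'a measure"
    and B :: "real \<Rightarrow> 'a \<Rightarrow> real" +
  fixes H :: "real \<Rightarrow> real \<Rightarrow> real" and X :: "real \<Rightarrow> 'a \<Rightarrow> real"
  assumes X_adapted: "\<And>t. t \<in> {0..T} \<Longrightarrow> X t \<in> borel_measurable (F t)"
    and X_continuous: "AE \<omega> in M. continuous_on {0..T} (\<lambda>t. X t \<omega>)"
    and X_eq_integral: "\<And>t. t \<in> {0..T} \<Longrightarrow>
      has_ito_integral M F B t (\<lambda>s \<omega>. rfbm_kernel H t s (X s \<omega>)) (X t)"

text \<open>The attention weight \<open>\<rho>(t,s;x)\<close> of a single path \<open>x\<close>, for \<open>0 \<le> s < t\<close>.\<close>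

definition attention_weight ::
  "(real \<Rightarrow> real \<Rightarrow> real) \<Rightarrow> real \<Rightarrow> real \<Rightarrow> (real \<Rightarrow> real) \<Rightarrow> real"
where
  "attention_weight H t s x =
     rfbm_kernel H t s (x s) / (LBINT u:{0..<t}. rfbm_kernel H t u (x u))"

end

theory Submission
  imports Defs
begin

text \<open>
  The bounds hold for every continuous path \<open>x\<close>, and almost every path of \<open>X\<close> is continuous.
  Continuity of \<open>x\<close> makes the exponent \<open>u \<mapsto> H u (x u)\<close> continuous
  (\<open>continuous_on_response_path\<close>), hence the kernel Borel measurable in \<open>u\<close>, so that the
  normalising integral can be compared with others (the Bochner integral of a non-measurable
  function would be \<open>0\<close>).

  Write \<open>a = h_min\<close>, \<open>b = h_max\<close>. For \<open>r > 0\<close> the power \<open>r\<^sup>p\<close> is monotone in the exponent \<open>p\<close>,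
  increasing or decreasing according to whether \<open>r \<ge> 1\<close> or \<open>r \<le> 1\<close>; in both cases it lies between
  its values at the ends of an interval of exponents. This bounds the numerator of the weight
  (\<open>rfbm_kernel_lower\<close>, \<open>rfbm_kernel_upper\<close>). For the denominator, splitting the integral where
  \<open>t - u\<close> crosses \<open>1\<close> can be avoided by scaling: with \<open>w = (t - u) / t \<in> (0,1]\<close>,
  \[ (t-u)^{h-1/2} = t^{h-1/2} w^{h-1/2}, \qquad w^{b-1/2} \le w^{h-1/2} \le w^{a-1/2}, \]
  and \<open>w\<^sup>c\<close> integrates to \<open>t / (c + 1)\<close> over \<open>[0,t)\<close>. Up to the constants, the denominator thus lies
  between the minimum and the maximum of \<open>t powr (a + 1/2)\<close> and \<open>t powr (b + 1/2)\<close>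
  (\<open>rfbm_normalizer_bounds\<close>). The quotient of the two estimates is \<open>attention_weight_bounds\<close>; the
  cases of the theorem only decide which terms are the minimum and the maximum, and then replace
  \<open>t\<close> by \<open>1\<close> or by \<open>t - s \<le> t\<close> in some of the denominators.
\<close>

section \<open>Powers with varying exponent\<close>

lemma powr_ge_min:
  fixes r :: real
  assumes "0 < r" "p \<le> h" "h \<le> q"
  shows "min (r powr p) (r powr q) \<le> r powr h"
proof (cases "r \<le> 1")
  case True
  then have "r powr q \<le> r powr h" using assms by (intro powr_mono') auto
  then show ?thesis by simp
next
  case False
  then have "r powr p \<le> r powr h" using assms by (intro powr_mono) auto
  then show ?thesis by simp
qed

lemma powr_le_max:
  fixes r :: real
  assumes "0 < r" "p \<le> h" "h \<le> q"
  shows "r powr h \<le> max (r powr p) (r powr q)"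
proof (cases "r \<le> 1")
  case True
  then have "r powr h \<le> r powr p" using assms by (intro powr_mono') auto
  then show ?thesis by simp
next
  case False
  then have "r powr h \<le> r powr q" using assms by (intro powr_mono) auto
  then show ?thesis by simp
qed

lemma min_powr_le_one:
  fixes r :: real
  assumes "0 < r" "r \<le> 1" "p \<le> q"
  shows "min (r powr p) (r powr q) = r powr q" "max (r powr p) (r powr q) = r powr p"
  using powr_mono'[of p q r] assms by auto

lemma min_powr_ge_one:
  fixes r :: real
  assumes "1 \<le> r" "p \<le> q"
  shows "min (r powr p) (r powr q) = r powr p" "max (r powr p) (r powr q) = r powr q"
  using powr_mono[of p q r] assms by auto

section \<open>Integrating the comparison kernel\<close>

text \<open>
  For \<open>c < 0\<close> the integrand is unbounded at \<open>t\<close>, but its antiderivative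
  \<open>- t / (c + 1) * ((t - u) / t) powr (c + 1)\<close> is continuous on all of \<open>[0,t]\<close>, which is enough for
  the fundamental theorem of calculus.
\<close>

lemma scaled_power_set_integral:
  fixes t c :: real
  assumes t: "0 < t" and c: "-1 < c"
  shows "set_integrable lborel {0..<t} (\<lambda>u. ((t - u) / t) powr c)"
    and "(LBINT u:{0..<t}. ((t - u) / t) powr c) = t / (c + 1)"
proof -
  let ?f = "\<lambda>u. ((t - u) / t) powr c"
  let ?G = "\<lambda>u. - (t / (c + 1)) * ((t - u) / t) powr (c + 1)"
  have "(?f has_integral (?G t - ?G 0)) {0..t}"
  proof (rule fundamental_theorem_of_calculus_interior)
    show "continuous_on {0..t} ?G"
      using t c by (intro continuous_intros continuous_on_powr') auto
    fix u assume u: "u \<in> {0<..<t}"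
    have "((\<lambda>u. (t - u) / t) has_real_derivative - 1 / t) (at u)"
      using t by - (rule derivative_eq_intros refl | simp)+
    then have "(?G has_real_derivative
        - (t / (c + 1)) * ((c + 1) * ((t - u) / t) powr (c + 1 - of_nat 1) * (- 1 / t))) (at u)"
      using u t by (intro DERIV_cmult DERIV_fun_powr) auto
    moreover have "- (t / (c + 1)) * ((c + 1) * z * (- 1 / t)) = z" for z
      using t c by (simp add: divide_simps)
    then have "- (t / (c + 1)) * ((c + 1) * ((t - u) / t) powr (c + 1 - of_nat 1) * (- 1 / t)) = ?f u"
      by simp
    ultimately show "(?G has_vector_derivative ?f u) (at u)"
      by (simp add: has_real_derivative_iff_has_vector_derivative)
  qed (use t in auto)
  then have "(?f has_integral t / (c + 1)) {0..t}"
    using t c by simp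
  moreover have "{u \<in> {0..t} - {0..<t}. ?f u \<noteq> 0} = {}" "{u \<in> {0..<t} - {0..t}. ?f u \<noteq> 0} = {}"
    by auto
  then have "(?f has_integral t / (c + 1)) {0..t} \<longleftrightarrow> (?f has_integral t / (c + 1)) {0..<t}"
    by (intro has_integral_spike_set_eq) (simp_all only: negligible_empty)
  ultimately have I: "(?f has_integral t / (c + 1)) {0..<t}"
    by blast
  show int: "set_integrable lborel {0..<t} ?f"
  proof -
    have "?f absolutely_integrable_on {0..<t}"
      using I by (intro nonnegative_absolutely_integrable_1) auto
    then show ?thesis
      unfolding set_integrable_def by (subst (asm) integrable_completion) auto
  qed
  show "(LBINT u:{0..<t}. ?f u) = t / (c + 1)"
    using set_borel_integral_eq_integral(2)[OF int] I by (simp add: integral_unique)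
qed

section \<open>Kernel and normaliser along a fixed path\<close>

lemma rfbm_kernel_lower:
  assumes "0 \<le> a" "a \<le> H s y" "H s y \<le> b" "s < t"
  shows "sqrt (2 * a) * min ((t - s) powr (a - 1/2)) ((t - s) powr (b - 1/2)) \<le> rfbm_kernel H t s y"
  unfolding rfbm_kernel_def using assms by (intro mult_mono powr_ge_min) auto

lemma rfbm_kernel_upper:
  assumes "0 \<le> a" "a \<le> H s y" "H s y \<le> b" "s < t"
  shows "rfbm_kernel H t s y \<le> sqrt (2 * b) * max ((t - s) powr (a - 1/2)) ((t - s) powr (b - 1/2))"
  unfolding rfbm_kernel_def using assms by (intro mult_mono powr_le_max) auto

text \<open>
  Compared with \<open>rfbm_kernel_lower\<close> and \<open>rfbm_kernel_upper\<close>, these bounds depend on \<open>s\<close> through a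
  single power of \<open>(t - s) / t\<close> and so can be integrated in closed form. They come from applying the
  bounds on powers to the factors \<open>t\<close> and \<open>(t - s) / t \<le> 1\<close> of \<open>t - s\<close> separately.
\<close>

lemma rfbm_kernel_scaled_bounds:
  assumes "0 \<le> a" "a \<le> H s y" "H s y \<le> b" "0 \<le> s" "s < t"
  shows "sqrt (2 * a) * min (t powr (a - 1/2)) (t powr (b - 1/2)) * ((t - s) / t) powr (b - 1/2)
      \<le> rfbm_kernel H t s y"
    and "rfbm_kernel H t s y
      \<le> sqrt (2 * b) * max (t powr (a - 1/2)) (t powr (b - 1/2)) * ((t - s) / t) powr (a - 1/2)"
proof -
  let ?h = "H s y - 1/2"
  have w: "0 < (t - s) / t" "(t - s) / t \<le> 1" using assms by auto
  have "(t - s) powr ?h = (t * ((t - s) / t)) powr ?h" using assms by simp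
  also have "\<dots> = t powr ?h * ((t - s) / t) powr ?h"
    using assms w by (intro powr_mult)
  finally have K: "rfbm_kernel H t s y = sqrt (2 * H s y) * t powr ?h * ((t - s) / t) powr ?h"
    by (simp add: rfbm_kernel_def)
  show "sqrt (2 * a) * min (t powr (a - 1/2)) (t powr (b - 1/2)) * ((t - s) / t) powr (b - 1/2)
      \<le> rfbm_kernel H t s y"
    unfolding K using assms w by (intro mult_mono powr_ge_min powr_mono') auto
  show "rfbm_kernel H t s y
      \<le> sqrt (2 * b) * max (t powr (a - 1/2)) (t powr (b - 1/2)) * ((t - s) / t) powr (a - 1/2)"
    unfolding K using assms w by (intro mult_mono powr_le_max powr_mono') (auto simp: le_max_iff_disj)
qed

lemma rfbm_normalizer_bounds:
  fixes x :: "real \<Rightarrow> real"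
  assumes a: "0 < a" and t: "0 < t"
    and H: "\<And>u. u \<in> {0..<t} \<Longrightarrow> a \<le> H u (x u) \<and> H u (x u) \<le> b"
    and cont: "continuous_on {0..<t} (\<lambda>u. H u (x u))"
  shows "sqrt (2 * a) / (b + 1/2) * min (t powr (a + 1/2)) (t powr (b + 1/2))
      \<le> (LBINT u:{0..<t}. rfbm_kernel H t u (x u))"
    and "(LBINT u:{0..<t}. rfbm_kernel H t u (x u))
      \<le> sqrt (2 * b) / (a + 1/2) * max (t powr (a + 1/2)) (t powr (b + 1/2))"
proof -
  let ?K = "\<lambda>u. rfbm_kernel H t u (x u)"
  let ?m = "sqrt (2 * a) * min (t powr (a - 1/2)) (t powr (b - 1/2))"
  let ?M = "sqrt (2 * b) * max (t powr (a - 1/2)) (t powr (b - 1/2))"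
  have ab: "a \<le> b" using H[of 0] t by auto
  have low: "?m * ((t - u) / t) powr (b - 1/2) \<le> ?K u"
    and up: "?K u \<le> ?M * ((t - u) / t) powr (a - 1/2)" if "u \<in> {0..<t}" for u
    using rfbm_kernel_scaled_bounds[of a H u "x u" b t] H[OF that] a that by auto
  have nonneg: "0 \<le> ?K u" if "u \<in> {0..<t}" for u
    using H[OF that] a by (simp add: rfbm_kernel_def)
  have "continuous_on {0..<t} ?K"
    unfolding rfbm_kernel_def using cont by (intro continuous_intros) auto
  then have meas: "set_borel_measurable lborel {0..<t} ?K"
    using borel_measurable_continuous_on_indicator[of "{0..<t}" ?K]
    by (simp add: set_borel_measurable_def)
  have lowI: "set_integrable lborel {0..<t} (\<lambda>u. ?m * ((t - u) / t) powr (b - 1/2))"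
    and upI: "set_integrable lborel {0..<t} (\<lambda>u. ?M * ((t - u) / t) powr (a - 1/2))"
    using a ab t by (intro set_integrable_mult_right scaled_power_set_integral(1); simp)+
  have KI: "set_integrable lborel {0..<t} ?K"
    by (rule set_integrable_bound[OF upI meas]) (use up nonneg in force)
  have tp: "t * t powr (p - 1/2) = t powr (p + 1/2)" for p
    using t powr_add[of t 1 "p - 1/2"] by (simp add: add.commute)
  have tmin: "min (t powr (a + 1/2)) (t powr (b + 1/2)) = t * min (t powr (a - 1/2)) (t powr (b - 1/2))"
    and tmax: "max (t powr (a + 1/2)) (t powr (b + 1/2)) = t * max (t powr (a - 1/2)) (t powr (b - 1/2))"
    unfolding tp[symmetric] using t by (simp_all add: min_mult_distrib_left max_mult_distrib_left)
  have "sqrt (2 * a) / (b + 1/2) * min (t powr (a + 1/2)) (t powr (b + 1/2)) = ?m * (t / (b + 1/2))"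
    unfolding tmin by simp
  also have "\<dots> = (LBINT u:{0..<t}. ?m * ((t - u) / t) powr (b - 1/2))"
    using scaled_power_set_integral(2)[OF t, of "b - 1/2"] a ab by simp
  also have "\<dots> \<le> (LBINT u:{0..<t}. ?K u)"
    by (rule set_integral_mono[OF lowI KI low])
  finally show "sqrt (2 * a) / (b + 1/2) * min (t powr (a + 1/2)) (t powr (b + 1/2))
      \<le> (LBINT u:{0..<t}. ?K u)" .
  have "(LBINT u:{0..<t}. ?K u) \<le> (LBINT u:{0..<t}. ?M * ((t - u) / t) powr (a - 1/2))"
    by (rule set_integral_mono[OF KI upI up])
  also have "\<dots> = ?M * (t / (a + 1/2))"
    using scaled_power_set_integral(2)[OF t, of "a - 1/2"] a by simp
  also have "\<dots> = sqrt (2 * b) / (a + 1/2) * max (t powr (a + 1/2)) (t powr (b + 1/2))"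
    unfolding tmax by simp
  finally show "(LBINT u:{0..<t}. ?K u)
      \<le> sqrt (2 * b) / (a + 1/2) * max (t powr (a + 1/2)) (t powr (b + 1/2))" .
qed

lemma attention_weight_bounds:
  fixes x :: "real \<Rightarrow> real"
  assumes a: "0 < a" and s: "0 \<le> s" "s < t"
    and H: "\<And>u. u \<in> {0..<t} \<Longrightarrow> a \<le> H u (x u) \<and> H u (x u) \<le> b"
    and cont: "continuous_on {0..<t} (\<lambda>u. H u (x u))"
  shows "sqrt a * (a + 1/2) / sqrt b *
      (min ((t - s) powr (a - 1/2)) ((t - s) powr (b - 1/2)) /
       max (t powr (a + 1/2)) (t powr (b + 1/2))) \<le> attention_weight H t s x"
    and "attention_weight H t s x \<le> sqrt b * (b + 1/2) / sqrt a *
      (max ((t - s) powr (a - 1/2)) ((t - s) powr (b - 1/2)) /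
       min (t powr (a + 1/2)) (t powr (b + 1/2)))"
proof -
  have t: "0 < t" and ab: "a \<le> b" using s H[of s] by auto
  define D where "D = (LBINT u:{0..<t}. rfbm_kernel H t u (x u))"
  define K where "K = rfbm_kernel H t s (x s)"
  define kl where "kl = min ((t - s) powr (a - 1/2)) ((t - s) powr (b - 1/2))"
  define ku where "ku = max ((t - s) powr (a - 1/2)) ((t - s) powr (b - 1/2))"
  define dl where "dl = min (t powr (a + 1/2)) (t powr (b + 1/2))"
  define du where "du = max (t powr (a + 1/2)) (t powr (b + 1/2))"
  have pos: "0 < kl" "0 < ku" "0 < dl" "0 < du"
    using s t by (auto simp: kl_def ku_def dl_def du_def less_max_iff_disj)
  have K: "sqrt (2 * a) * kl \<le> K" "K \<le> sqrt (2 * b) * ku"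
    unfolding K_def kl_def ku_def
    using rfbm_kernel_lower[of a H s "x s" b t] rfbm_kernel_upper[of a H s "x s" b t] a s H[of s]
    by auto
  have D: "sqrt (2 * a) / (b + 1/2) * dl \<le> D" "D \<le> sqrt (2 * b) / (a + 1/2) * du"
    unfolding D_def dl_def du_def
    using rfbm_normalizer_bounds[of a t H x b] a t H cont by auto
  have Dl: "0 < sqrt (2 * a) / (b + 1/2) * dl" using a ab pos by simp
  then have Dpos: "0 < D" using D(1) by linarith
  have "0 \<le> sqrt (2 * a) * kl" using a pos by simp
  then have Kpos: "0 \<le> K" using K(1) by linarith
  have rho: "attention_weight H t s x = K / D"
    by (simp add: attention_weight_def K_def D_def)
  have "sqrt a * (a + 1/2) / sqrt b * (kl / du) = (sqrt (2 * a) * kl) / (sqrt (2 * b) / (a + 1/2) * du)"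
    using a ab pos by (simp add: real_sqrt_mult field_simps)
  also have "\<dots> \<le> K / D" using K D Dpos Kpos by (intro frac_le) auto
  finally show "sqrt a * (a + 1/2) / sqrt b * (kl / du) \<le> attention_weight H t s x"
    by (simp add: rho)
  have "K / D \<le> (sqrt (2 * b) * ku) / (sqrt (2 * a) / (b + 1/2) * dl)"
    using K D Dl Kpos by (intro frac_le) auto
  also have "\<dots> = sqrt b * (b + 1/2) / sqrt a * (ku / dl)"
    using a ab pos by (simp add: real_sqrt_mult field_simps)
  finally show "attention_weight H t s x \<le> sqrt b * (b + 1/2) / sqrt a * (ku / dl)"
    by (simp add: rho)
qed

section \<open>The response along a continuous path\<close>

text \<open>
  Separate moduli of continuity suffice for joint continuity because the Lipschitz constant in
  space does not depend on the time.
\<close>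

lemma continuous_on_response_path:
  fixes x :: "real \<Rightarrow> real"
  assumes H: "lipschitz_hoelder_response T a b H" and x: "continuous_on {0..T} x"
  shows "continuous_on {0..T} (\<lambda>u. H u (x u))"
proof -
  obtain L C \<gamma> where L: "\<And>t x y. t \<in> {0..T} \<Longrightarrow> \<bar>H t x - H t y\<bar> \<le> L * \<bar>x - y\<bar>"
    and \<gamma>: "0 < \<gamma>"
    and C: "\<And>t s x. t \<in> {0..T} \<Longrightarrow> s \<in> {0..T} \<Longrightarrow> \<bar>H t x - H s x\<bar> \<le> C * \<bar>t - s\<bar> powr \<gamma>"
    using H unfolding lipschitz_hoelder_response_def by metis
  show ?thesis
    unfolding continuous_on_def
  proof
    fix v assume v: "v \<in> {0..T}"
    let ?g = "\<lambda>u. L * \<bar>x u - x v\<bar> + C * \<bar>u - v\<bar> powr \<gamma>"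
    have xv: "(x \<longlongrightarrow> x v) (at v within {0..T})"
      using x v by (auto simp: continuous_on_def)
    have "((\<lambda>u. \<bar>u - v\<bar> powr \<gamma>) \<longlongrightarrow> 0) (at v within {0..T})"
      using \<gamma> by (intro tendsto_zero_powrI[where b = \<gamma>]) (auto intro!: tendsto_eq_intros)
    then have "(?g \<longlongrightarrow> L * \<bar>x v - x v\<bar> + C * 0) (at v within {0..T})"
      by (intro tendsto_intros xv)
    then have g: "(?g \<longlongrightarrow> 0) (at v within {0..T})"
      by simp
    have "\<bar>H u (x u) - H v (x v)\<bar> \<le> ?g u" if "u \<in> {0..T}" for u
      using L[OF that, of "x u" "x v"] C[OF that v, of "x v"] by linarith
    then have "\<forall>\<^sub>F u in at v within {0..T}. norm (H u (x u) - H v (x v)) \<le> ?g u"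
      by (auto simp: eventually_at_filter)
    then show "((\<lambda>u. H u (x u)) \<longlongrightarrow> H v (x v)) (at v within {0..T})"
      by (rule LIM_zero_cancel[OF Lim_null_comparison[OF _ g]])
  qed
qed

section \<open>Bounds on the attention weights\<close>

theorem theorem6p5:
  fixes M :: "'a measure" and T :: real and F :: "real \<Rightarrow> 'a measure"
    and B X :: "real \<Rightarrow> 'a \<Rightarrow> real" and H :: "real \<Rightarrow> real \<Rightarrow> real"
    and h_min h_max A\<^sub>1 A\<^sub>2 A\<^sub>3 A\<^sub>4 A\<^sub>5 B\<^sub>1 B\<^sub>2 B\<^sub>3 B\<^sub>4 B\<^sub>5 :: real
  assumes "T > 0"
    and "lipschitz_hoelder_response T h_min h_max H"
    and "responsive_fbm M T F B H X"
    and "A\<^sub>1 = sqrt h_min * (h_min + 1/2) / sqrt h_max"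
    and "A\<^sub>2 = A\<^sub>1" and "A\<^sub>3 = A\<^sub>1" and "A\<^sub>4 = A\<^sub>1"
    and "B\<^sub>1 = sqrt h_max * (h_max + 1/2) / sqrt h_min"
    and "B\<^sub>2 = B\<^sub>1" and "B\<^sub>3 = B\<^sub>1" and "B\<^sub>4 = B\<^sub>1"
    and "A\<^sub>5 = sqrt h_min * (h_min + 1/2) / (2 * sqrt h_max)"
    and "B\<^sub>5 = 2 * sqrt h_max * (h_max + 1/2) / sqrt h_min"
  shows "AE \<omega> in M. \<forall>t s. 0 \<le> s \<and> s < t \<and> t \<le> T \<longrightarrow>
    (let \<rho> = (\<lambda>t s. attention_weight H t s (\<lambda>u. X u \<omega>)) in
      (t \<le> 1 \<longrightarrow>
        (t - s < 1 \<longrightarrow>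
           A\<^sub>1 * (t - s) powr (h_max - 1/2) \<le> \<rho> t s \<and>
           \<rho> t s \<le> B\<^sub>1 * (t - s) powr (h_min - h_max - 1)) \<and>
        (t - s = 1 \<longrightarrow> A\<^sub>2 \<le> \<rho> 1 0 \<and> \<rho> 1 0 \<le> B\<^sub>2)) \<and>
      (t > 1 \<longrightarrow>
        (t - s < 1 \<longrightarrow>
           A\<^sub>3 * ((t - s) powr (h_max - 1/2) / t powr (h_max + 1/2)) \<le> \<rho> t s \<and>
           \<rho> t s \<le> B\<^sub>3 * (t - s) powr (- 1)) \<and>
        (t - s > 1 \<longrightarrow>
           A\<^sub>4 * ((t - s) powr (h_min - 1/2) / t powr (h_max + 1/2)) \<le> \<rho> t s \<and>
           \<rho> t s \<le> B\<^sub>4 * (t - s) powr (h_max - h_min - 1)) \<and>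
        (t - s = 1 \<longrightarrow>
           A\<^sub>5 * (1 / t powr (h_max + 1/2)) \<le> \<rho> t (t - 1) \<and>
           \<rho> t (t - 1) \<le> B\<^sub>5 * (1 / t powr (h_min + 1/2)))))"
proof -
  let ?a = h_min and ?b = h_max
  have a: "0 < ?a" "?a \<le> ?b"
    and Hbd: "\<And>u y. u \<in> {0..T} \<Longrightarrow> ?a \<le> H u y \<and> H u y \<le> ?b"
    using assms(2) by (auto simp: lipschitz_hoelder_response_def)
  have A: "0 \<le> A\<^sub>1" "A\<^sub>5 = A\<^sub>1 / 2" and B: "0 \<le> B\<^sub>1" "B\<^sub>5 = 2 * B\<^sub>1"
    using a assms(4,8,12,13) by auto
  note eqs = assms(5-7,9-11) A(2) B(2)
  have "AE \<omega> in M. continuous_on {0..T} (\<lambda>t. X t \<omega>)"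
    using assms(3) by (rule responsive_fbm.X_continuous)
  then show ?thesis
  proof eventually_elim
    case (elim \<omega>)
    let ?w = "\<lambda>t s. attention_weight H t s (\<lambda>u. X u \<omega>)"
    have cont: "continuous_on {0..T} (\<lambda>u. H u (X u \<omega>))"
      by (rule continuous_on_response_path[OF assms(2) elim])
    show ?case
    proof (intro allI impI)
      fix t s :: real assume st: "0 \<le> s \<and> s < t \<and> t \<le> T"
      define r where "r = t - s"
      have r: "0 < r" "r \<le> t" "0 < t" using st by (auto simp: r_def)
      have ct: "continuous_on {0..<t} (\<lambda>u. H u (X u \<omega>))"
        using cont by (rule continuous_on_subset) (use st in auto)
      have Hb: "?a \<le> H u (X u \<omega>) \<and> H u (X u \<omega>) \<le> ?b" if "u \<in> {0..<t}" for u
        using Hbd[of u] that st by auto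
      have low: "A\<^sub>1 * (min (r powr (?a - 1/2)) (r powr (?b - 1/2)) /
          max (t powr (?a + 1/2)) (t powr (?b + 1/2))) \<le> ?w t s"
        and up: "?w t s \<le> B\<^sub>1 * (max (r powr (?a - 1/2)) (r powr (?b - 1/2)) /
          min (t powr (?a + 1/2)) (t powr (?b + 1/2)))"
        unfolding assms(4,8) r_def using attention_weight_bounds[of ?a s t H "\<lambda>u. X u \<omega>" ?b] a st Hb ct
        by auto
      have lowI: "A\<^sub>1 * z \<le> ?w t s" if "z \<le> min (r powr (?a - 1/2)) (r powr (?b - 1/2)) /
          max (t powr (?a + 1/2)) (t powr (?b + 1/2))" for z
        using mult_left_mono[OF that A(1)] low by linarith
      have upI: "?w t s \<le> B\<^sub>1 * z" if "max (r powr (?a - 1/2)) (r powr (?b - 1/2)) /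
          min (t powr (?a + 1/2)) (t powr (?b + 1/2)) \<le> z" for z
        using mult_left_mono[OF that B(1)] up by linarith
      \<comment> \<open>Since \<open>r \<le> t\<close>, a power of \<open>t\<close> in a denominator can be traded for one of \<open>r\<close>; this is
        where the exponents of the upper bounds in terms of \<open>t - s\<close> alone come from.\<close>
      have quot: "r powr p / t powr q \<le> r powr (p - q)" if "0 \<le> q" for p q
        using r that unfolding powr_diff by (intro divide_left_mono powr_mono2) auto
      have I: "A\<^sub>1 * r powr (?b - 1/2) \<le> ?w t s" "?w t s \<le> B\<^sub>1 * r powr (?a - ?b - 1)"
        if "t \<le> 1"
      proof -
        have r1: "r \<le> 1" using r that by simp
        have "r powr (?b - 1/2) \<le> r powr (?b - 1/2) / t powr (?a + 1/2)"
          using r that a by (simp add: le_divide_eq mult_left_le powr_le1)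
        then show "A\<^sub>1 * r powr (?b - 1/2) \<le> ?w t s"
          using r r1 that a by (intro lowI) (simp add: min_powr_le_one)
        show "?w t s \<le> B\<^sub>1 * r powr (?a - ?b - 1)"
          using r r1 that a quot[of "?b + 1/2" "?a - 1/2"]
          by (intro upI) (simp add: min_powr_le_one algebra_simps)
      qed
      have IIa: "A\<^sub>1 * (r powr (?b - 1/2) / t powr (?b + 1/2)) \<le> ?w t s"
        "?w t s \<le> B\<^sub>1 * r powr (- 1)" if "1 < t" "r < 1"
      proof -
        show "A\<^sub>1 * (r powr (?b - 1/2) / t powr (?b + 1/2)) \<le> ?w t s"
          using r that a by (intro lowI) (simp add: min_powr_le_one min_powr_ge_one)
        show "?w t s \<le> B\<^sub>1 * r powr (- 1)"
          using r that a quot[of "?a + 1/2" "?a - 1/2"]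
          by (intro upI) (simp add: min_powr_le_one min_powr_ge_one)
      qed
      have IIb: "A\<^sub>1 * (r powr (?a - 1/2) / t powr (?b + 1/2)) \<le> ?w t s"
        "?w t s \<le> B\<^sub>1 * r powr (?b - ?a - 1)" if "1 < t" "1 < r"
      proof -
        show "A\<^sub>1 * (r powr (?a - 1/2) / t powr (?b + 1/2)) \<le> ?w t s"
          using that a by (intro lowI) (simp add: min_powr_ge_one)
        show "?w t s \<le> B\<^sub>1 * r powr (?b - ?a - 1)"
          using that a quot[of "?a + 1/2" "?b - 1/2"]
          by (intro upI) (simp add: min_powr_ge_one algebra_simps)
      qed
      have IIc: "A\<^sub>1 / 2 * (1 / t powr (?b + 1/2)) \<le> ?w t (t - 1)"
        "?w t (t - 1) \<le> 2 * B\<^sub>1 * (1 / t powr (?a + 1/2))" if "1 < t" "r = 1"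
      proof -
        have s: "s = t - 1" using that(2) by (simp add: r_def)
        have "A\<^sub>1 * (1 / t powr (?b + 1/2)) \<le> ?w t s"
          using that a by (intro lowI) (simp add: min_powr_ge_one)
        moreover have "?w t s \<le> B\<^sub>1 * (1 / t powr (?a + 1/2))"
          using that a by (intro upI) (simp add: min_powr_ge_one)
        moreover have "0 \<le> A\<^sub>1 * (1 / t powr (?b + 1/2))" "0 \<le> B\<^sub>1 * (1 / t powr (?a + 1/2))"
          using A(1) B(1) by simp_all
        ultimately show "A\<^sub>1 / 2 * (1 / t powr (?b + 1/2)) \<le> ?w t (t - 1)"
          "?w t (t - 1) \<le> 2 * B\<^sub>1 * (1 / t powr (?a + 1/2))"
          unfolding s by linarith+
      qed
      have Ib: "A\<^sub>1 \<le> ?w 1 0" "?w 1 0 \<le> B\<^sub>1" if "t \<le> 1" "r = 1"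
      proof -
        have "t = 1" "s = 0" using that r st by (auto simp: r_def)
        then show "A\<^sub>1 \<le> ?w 1 0" "?w 1 0 \<le> B\<^sub>1" using I that by auto
      qed
      show "let \<rho> = ?w in
        (t \<le> 1 \<longrightarrow>
          (t - s < 1 \<longrightarrow>
             A\<^sub>1 * (t - s) powr (h_max - 1/2) \<le> \<rho> t s \<and>
             \<rho> t s \<le> B\<^sub>1 * (t - s) powr (h_min - h_max - 1)) \<and>
          (t - s = 1 \<longrightarrow> A\<^sub>2 \<le> \<rho> 1 0 \<and> \<rho> 1 0 \<le> B\<^sub>2)) \<and>
        (t > 1 \<longrightarrow>
          (t - s < 1 \<longrightarrow>
             A\<^sub>3 * ((t - s) powr (h_max - 1/2) / t powr (h_max + 1/2)) \<le> \<rho> t s \<and>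
             \<rho> t s \<le> B\<^sub>3 * (t - s) powr (- 1)) \<and>
          (t - s > 1 \<longrightarrow>
             A\<^sub>4 * ((t - s) powr (h_min - 1/2) / t powr (h_max + 1/2)) \<le> \<rho> t s \<and>
             \<rho> t s \<le> B\<^sub>4 * (t - s) powr (h_max - h_min - 1)) \<and>
          (t - s = 1 \<longrightarrow>
             A\<^sub>5 * (1 / t powr (h_max + 1/2)) \<le> \<rho> t (t - 1) \<and>
             \<rho> t (t - 1) \<le> B\<^sub>5 * (1 / t powr (h_min + 1/2))))"
        unfolding Let_def eqs r_def[symmetric] using I Ib IIa IIb IIc by (intro conjI impI) simp_all
    qed
  qed
qed

end
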